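(* Let $A\in\mathbb{C}^{n\times n}$ be a non-Hermitian positive definite matrix, $b\in\mathbb{C}^n$, and let $H=\frac12(A+A^* )$, $S=\frac12(A-A^* )$. For any $\alpha>0$ and $\omega\in[0,2)$, and every initial guess $x^{(0)}\in\mathbb{C}^n$, the sequence $(x^{(k)})_{k\ge0}$ defined by $$\begin{cases}(\alpha I+H)x^{(k+\frac12)}=(\alpha I-S)x^{(k)}+b,\\ (\alpha I+S)x^{(k+1)}=(S-(1-\omega)\alpha I)x^{(k)}+(2-\omega)\alpha x^{(k+\frac12)},\end{cases}\qquad k=0,1,2,\ldots$$ converges to the unique solution $x^*$ of $Ax=b$. Moreover, the spectral radius of $$T(\alpha,\omega)=(\alpha I+S)^{-1}(\alpha I+H)^{-1}\bigl(\alpha^2I+HS-(1-\omega)\alpha A\bigr)$$ satisfies $\rho(T(\alpha,\omega))<1$.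
   Context: $\rho(X)$ denotes the spectral radius of $X$, $X^*$ the conjugate transpose, $I$ the identity matrix. A (possibly non-Hermitian) matrix $X\in\mathbb{C}^{n\times n}$ is called positive definite if its Hermitian part $\frac12(X+X^* )$ is Hermitian positive definite. *)

theory Defs
  imports "HOL-Analysis.Analysis"
begin

definition conj_transpose :: "complex^'n^'m \<Rightarrow> complex^'m^'n" where
  "conj_transpose X = map_matrix cnj (transpose X)"

definition hermitian_matrix :: "complex^'n^'n \<Rightarrow> bool" where
  "hermitian_matrix X \<longleftrightarrow> conj_transpose X = X"

definition hermitian_part :: "complex^'n^'n \<Rightarrow> complex^'n^'n" where
  "hermitian_part X = (1/2) *\<^sub>R (X + conj_transpose X)"

definition skew_hermitian_part :: "complex^'n^'n \<Rightarrow> complex^'n^'n" where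
  "skew_hermitian_part X = (1/2) *\<^sub>R (X - conj_transpose X)"

(* The sum is v^* X v, which is real because X is Hermitian. *)
definition hermitian_posdef :: "complex^'n^'n \<Rightarrow> bool" where
  "hermitian_posdef X \<longleftrightarrow> hermitian_matrix X \<and>
     (\<forall>v. v \<noteq> 0 \<longrightarrow> Re (\<Sum>i\<in>UNIV. cnj (v $ i) * (X *v v) $ i) > 0)"

(* X itself need not be Hermitian. *)
definition posdef_matrix :: "complex^'n^'n \<Rightarrow> bool" where
  "posdef_matrix X \<longleftrightarrow> hermitian_posdef (hermitian_part X)"

definition matrix_spectrum :: "complex^'n^'n \<Rightarrow> complex set" where
  "matrix_spectrum X = {z. \<exists>v. v \<noteq> 0 \<and> X *v v = z *s v}"

(* Max is meaningful: a complex square matrix of positive size has a finite nonempty spectrum. *)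
definition matrix_spectral_radius :: "complex^'n^'n \<Rightarrow> real" where
  "matrix_spectral_radius X = Max (norm ` matrix_spectrum X)"

(* xh k stands for the half-step iterate x^(k+1/2). *)
definition splitting_iteration ::
    "complex^'n^'n \<Rightarrow> complex^'n \<Rightarrow> real \<Rightarrow> real \<Rightarrow> (nat \<Rightarrow> complex^'n) \<Rightarrow> (nat \<Rightarrow> complex^'n) \<Rightarrow> bool"
  where
  "splitting_iteration A b \<alpha> \<omega> x xh \<longleftrightarrow>
     (let H = hermitian_part A; S = skew_hermitian_part A in
       \<forall>k. (\<alpha> *\<^sub>R mat 1 + H) *v xh k = (\<alpha> *\<^sub>R mat 1 - S) *v x k + b \<and>
           (\<alpha> *\<^sub>R mat 1 + S) *v x (Suc k) =
             (S - ((1 - \<omega>) * \<alpha>) *\<^sub>R mat 1) *v x k + ((2 - \<omega>) * \<alpha>) *\<^sub>R xh k)"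

definition iteration_matrix :: "complex^'n^'n \<Rightarrow> real \<Rightarrow> real \<Rightarrow> complex^'n^'n" where
  "iteration_matrix A \<alpha> \<omega> =
     (let H = hermitian_part A; S = skew_hermitian_part A in
       matrix_inv (\<alpha> *\<^sub>R mat 1 + S) ** matrix_inv (\<alpha> *\<^sub>R mat 1 + H) **
       (\<alpha>\<^sup>2 *\<^sub>R mat 1 + H ** S - ((1 - \<omega>) * \<alpha>) *\<^sub>R A))"

end

theory Submission
  imports Defs "HOL-Computational_Algebra.Fundamental_Theorem_Algebra"
begin

text \<open>
  Let \<open>N = \<alpha>\<^sup>2I + HS - (1 - \<omega>)\<alpha>A\<close>, so that the iteration matrix is
  \<open>T = (\<alpha>I + S)\<^sup>-\<^sup>1(\<alpha>I + H)\<^sup>-\<^sup>1N\<close>. The key observation is that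
  \<open>N = (1 - \<omega>/2)(\<alpha>I - H)(\<alpha>I - S) + (\<omega>/2)(\<alpha>I + H)(\<alpha>I + S)\<close>. Hence \<open>T\<close> is similar, through
  \<open>\<alpha>I + S\<close>, to
  \<open>(1 - \<omega>/2) C\<^sub>H C\<^sub>S + (\<omega>/2) I\<close>, where
  \<open>C\<^sub>H = (\<alpha>I + H)\<^sup>-\<^sup>1(\<alpha>I - H)\<close> and \<open>C\<^sub>S = (\<alpha>I - S)(\<alpha>I + S)\<^sup>-\<^sup>1\<close> are Cayley transforms.
  As \<open>S\<close> is skew-Hermitian, \<open>C\<^sub>S\<close> is an isometry; as \<open>H\<close> is positive definite, \<open>C\<^sub>H\<close> has norm
  at most some \<open>q < 1\<close> (\<open>cayley_transform_contracts\<close>). Thus in the norm \<open>v \<mapsto> \<parallel>(\<alpha>I + S) v\<parallel>\<close> the map \<open>T\<close>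
  contracts by the factor \<open>c = (1 - \<omega>/2) q + \<omega>/2\<close>, which is below \<open>1\<close> because \<open>\<omega> < 2\<close>
  (\<open>splitting_step_contracts\<close>).

  Both claims follow from this single contraction. The errors obey the recursion
  \<open>e\<^sub>k\<^sub>+\<^sub>1 = T e\<^sub>k\<close> (\<open>splitting_iteration_error\<close>) and therefore decay geometrically; and every
  eigenvalue of \<open>T\<close> has modulus at most \<open>c\<close>. To conclude about the spectral radius, which is a
  maximum over the spectrum, one also needs the spectrum to be finite and nonempty; it is the root set of
  the nonconstant characteristic polynomial (\<open>matrix_spectrum_eq_roots\<close>, \<open>charpoly_nonconstant\<close>).
\<close>

section \<open>Strict contractions and complex matrices as real-linear maps\<close>

text \<open>
  The unit sphere is compact, so the pointwise strict inequality improves to a uniform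
  factor: the maximum of \<open>norm \<circ> f\<close> on the sphere is attained, hence below \<open>1\<close>.
\<close>

lemma contraction_of_norm_decreasing:
  fixes f :: "'a::euclidean_space \<Rightarrow> 'b::euclidean_space"
  assumes "linear f" and dec: "\<And>x. x \<noteq> 0 \<Longrightarrow> norm (f x) < norm x"
  obtains q where "0 \<le> q" "q < 1" "\<And>x. norm (f x) \<le> q * norm x"
proof -
  interpret f: linear f by fact
  obtain s where s: "s \<in> sphere (0::'a) 1" and max: "\<And>t. t \<in> sphere 0 1 \<Longrightarrow> norm (f t) \<le> norm (f s)"
  proof -
    have "(SOME i::'a. i \<in> Basis) \<in> sphere 0 1"
      using SOME_Basis by simp
    then have "sphere (0::'a) 1 \<noteq> {}" by blast
    moreover have "continuous_on (sphere 0 1) (\<lambda>x. norm (f x))"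
      using \<open>linear f\<close> by (intro continuous_on_norm linear_continuous_on) (simp add: linear_conv_bounded_linear)
    ultimately show thesis
      using continuous_attains_sup[of "sphere 0 1" "\<lambda>x. norm (f x)"] that by auto
  qed
  have "norm (f x) \<le> norm (f s) * norm x" for x
  proof (cases "x = 0")
    case True
    then show ?thesis by (simp add: f.zero)
  next
    case False
    have "norm (f (x /\<^sub>R norm x)) \<le> norm (f s)"
      using False by (intro max) simp
    then show ?thesis
      using False by (simp add: f.scale field_simps)
  qed
  moreover have "norm (f s) < 1"
    using dec[of s] s by (cases "s = 0") auto
  ultimately show thesis
    using that[of "norm (f s)"] by auto
qed

lemma scaleR_matrix_mult_vec:
  fixes M :: "complex^'n^'m"
  shows "(c *\<^sub>R M) *v x = c *\<^sub>R (M *v x)"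
  by (simp add: vec_eq_iff matrix_vector_mult_def scaleR_sum_right)

lemma linear_complex_matrix_vector_mult: "linear ((*v) (M :: complex^'n^'m))"
  by (rule linearI) (simp_all add: vec_eq_iff matrix_vector_mult_def algebra_simps sum.distrib scaleR_sum_right)

lemma invertible_if_ker_trivial:
  fixes M :: "complex^'n^'n"
  assumes "\<And>v. M *v v = 0 \<Longrightarrow> v = 0"
  shows "invertible M"
  using assms by (simp add: invertible_left_inverse matrix_left_invertible_ker)

lemma matrix_inv_cancel:
  fixes M :: "complex^'n^'n"
  assumes "invertible M"
  shows "M *v (matrix_inv M *v v) = v" "matrix_inv M *v (M *v v) = v"
proof -
  have "M ** matrix_inv M = mat 1 \<and> matrix_inv M ** M = mat 1"
    using assms unfolding invertible_def matrix_inv_def by (rule someI_ex)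
  then show "M *v (matrix_inv M *v v) = v" "matrix_inv M *v (M *v v) = v"
    by (simp_all add: matrix_vector_mul_assoc)
qed

text \<open>
  The real inner product on \<open>complex^'n\<close> is the real part of the Hermitian one. All
  estimates below concern \<open>Re (v\<^sup>* M v)\<close> and norms, so they can be made in the real Euclidean space.
\<close>

lemma inner_vec_complex:
  "v \<bullet> w = Re (\<Sum>i\<in>UNIV. cnj (v $ i) * w $ i)" for v w :: "complex^'n"
  by (simp add: inner_vec_def inner_complex_def)

lemma inner_conj_transpose:
  fixes M :: "complex^'n^'m"
  shows "(M *v v) \<bullet> w = v \<bullet> (conj_transpose M *v w)"
proof -
  have "(\<Sum>i\<in>UNIV. cnj ((M *v v) $ i) * w $ i) 
     = (\<Sum>i\<in>UNIV. \<Sum>j\<in>UNIV. cnj (M $ i $ j) * cnj (v $ j) * w $ i)"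
    by (simp add: matrix_vector_mult_def sum_distrib_right)
  also have "\<dots> = (\<Sum>j\<in>UNIV. \<Sum>i\<in>UNIV. cnj (M $ i $ j) * cnj (v $ j) * w $ i)"
    by (rule sum.swap)
  also have "\<dots> = (\<Sum>j\<in>UNIV. cnj (v $ j) * (conj_transpose M *v w) $ j)"
    by (simp add: matrix_vector_mult_def conj_transpose_def map_matrix_def transpose_def sum_distrib_left mult_ac)
  finally show ?thesis by (simp only: inner_vec_complex)
qed

text \<open>
  The quadratic forms of \<open>A\<close> and its conjugate transpose have the same real part; hence
  it survives in the Hermitian part of \<open>A\<close> and cancels in the skew-Hermitian part.
\<close>

lemma inner_hermitian_part: "v \<bullet> (hermitian_part A *v v) = v \<bullet> (A *v v)"
  using inner_conj_transpose[of A v v]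
  by (simp add: hermitian_part_def scaleR_matrix_mult_vec matrix_vector_mult_add_rdistrib
      inner_add_right inner_commute[of v])

lemma inner_skew_hermitian_part: "v \<bullet> (skew_hermitian_part A *v v) = 0"
  using inner_conj_transpose[of A v v]
  by (simp add: skew_hermitian_part_def scaleR_matrix_mult_vec matrix_vector_mult_diff_rdistrib
      inner_diff_right inner_commute[of v])

lemma hermitian_plus_skew: "hermitian_part A + skew_hermitian_part A = A"
  by (simp add: hermitian_part_def skew_hermitian_part_def scaleR_right_distrib scaleR_right_diff_distrib
      flip: scaleR_left_distrib)

lemma posdef_matrix_inner_pos:
  assumes "posdef_matrix A" "v \<noteq> 0"
  shows "v \<bullet> (hermitian_part A *v v) > 0"
  using assms by (simp add: posdef_matrix_def hermitian_posdef_def inner_vec_complex)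

lemma matrix_mult_vec_scaleR:
  fixes M :: "complex^'n^'m"
  shows "M *v (c *\<^sub>R x) = c *\<^sub>R (M *v x)"
  using linear_complex_matrix_vector_mult by (rule linear_cmul)

lemmas matrix_expression_mult_vec =
  scaleR_matrix_mult_vec matrix_mult_vec_scaleR matrix_vector_mult_add_rdistrib matrix_vector_mult_diff_rdistrib
  matrix_vector_right_distrib matrix_vector_mult_diff_distrib matrix_vector_mul_assoc[symmetric]

section \<open>The contraction estimate for one step\<close>

lemma invertible_shift_of_accretive:
  fixes M :: "complex^'n^'n"
  assumes "\<alpha> > 0" and nonneg: "\<And>v. v \<bullet> (M *v v) \<ge> 0"
  shows "invertible (\<alpha> *\<^sub>R mat 1 + M)"
proof (rule invertible_if_ker_trivial)
  fix v assume "(\<alpha> *\<^sub>R mat 1 + M) *v v = 0"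
  then have "0 = v \<bullet> ((\<alpha> *\<^sub>R mat 1 + M) *v v)" by simp
  also have "\<dots> = \<alpha> * (v \<bullet> v) + v \<bullet> (M *v v)"
    by (simp add: matrix_expression_mult_vec inner_add_right)
  finally have "\<alpha> * (v \<bullet> v) \<le> 0" using nonneg[of v] by simp
  then show "v = 0" using \<open>\<alpha> > 0\<close>
    by (metis inner_gt_zero_iff linorder_not_le mult_pos_pos)
qed

text \<open>
  The polarization identity behind both halves of the contraction estimate: for a
  skew-Hermitian \<open>M\<close> the right-hand side vanishes, so \<open>\<alpha>I + M\<close> and
  \<open>\<alpha>I - M\<close> stretch equally, whereas for a positive definite \<open>M\<close> and \<open>\<alpha> > 0\<close> the former stretches more.
\<close>

lemma norm_shift_add_minus:
  fixes M :: "complex^'n^'n"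
  shows "(norm ((\<alpha> *\<^sub>R mat 1 + M) *v v))\<^sup>2 - (norm ((\<alpha> *\<^sub>R mat 1 - M) *v v))\<^sup>2 = 4 * \<alpha> * (v \<bullet> (M *v v))"
  by (simp add: matrix_expression_mult_vec power2_norm_eq_inner inner_add_left inner_add_right
      inner_diff_left inner_diff_right inner_commute[of "M *v v" v] right_diff_distrib distrib_left)

text \<open>
  The two factors of the Cayley transform commute. Writing \<open>v = (\<alpha>I + H) y\<close>, the transform
  maps \<open>v\<close> to \<open>(\<alpha>I - H) y\<close>, which is strictly shorter by the polarization identity;
  compactness makes the ratio uniform.
\<close>

lemma cayley_transform_contracts:
  fixes H :: "complex^'n^'n"
  assumes "\<alpha> > 0" and pos: "\<And>v. v \<noteq> 0 \<Longrightarrow> v \<bullet> (H *v v) > 0"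
  obtains q where "0 \<le> q" "q < 1"
    "\<And>v. norm (matrix_inv (\<alpha> *\<^sub>R mat 1 + H) *v ((\<alpha> *\<^sub>R mat 1 - H) *v v)) \<le> q * norm v"
proof -
  let ?P = "\<alpha> *\<^sub>R mat 1 + H" and ?M = "\<alpha> *\<^sub>R mat 1 - H"
  let ?K = "\<lambda>v. matrix_inv ?P *v (?M *v v)"
  have inv: "invertible ?P"
    using \<open>\<alpha> > 0\<close> by (rule invertible_shift_of_accretive) (metis pos inner_zero_left less_eq_real_def)
  have "linear ?K"
    using linear_compose[OF linear_complex_matrix_vector_mult linear_complex_matrix_vector_mult]
    by (simp add: o_def)
  moreover have "norm (?K v) < norm v" if "v \<noteq> 0" for v
  proof -
    define y where "y = matrix_inv ?P *v v"
    have v: "v = ?P *v y" by (simp add: y_def matrix_inv_cancel[OF inv])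
    with that have "y \<noteq> 0" by auto
    have "?M *v v = ?P *v (?M *v y)"
      unfolding v by (simp add: matrix_expression_mult_vec algebra_simps)
    then have "?K v = ?M *v y" by (simp add: matrix_inv_cancel[OF inv])
    moreover have "(norm v)\<^sup>2 - (norm (?M *v y))\<^sup>2 > 0"
      unfolding v norm_shift_add_minus using pos[OF \<open>y \<noteq> 0\<close>] \<open>\<alpha> > 0\<close> by simp
    ultimately show ?thesis by (simp add: power_less_imp_less_base)
  qed
  ultimately show thesis using contraction_of_norm_decreasing[of ?K] that by blast
qed

text \<open>
  The hypothesis relating \<open>e\<close> and \<open>e'\<close> is one step of the error recursion with the
  inverses cleared, in which form it serves for the iterates and for eigenvectors alike. The factor
  \<open>c\<close> is a convex combination of the Cayley factor of \<open>H\<close> and \<open>1\<close>, with a positive weight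
  \<open>1 - \<omega>/2\<close> on the former.
\<close>

lemma splitting_step_contracts:
  fixes H S :: "complex^'n^'n"
  assumes "\<alpha> > 0" and "0 \<le> \<omega>" "\<omega> < 2"
    and pos: "\<And>v. v \<noteq> 0 \<Longrightarrow> v \<bullet> (H *v v) > 0"
    and skew: "\<And>v. v \<bullet> (S *v v) = 0"
  obtains c where "0 \<le> c" "c < 1"
    "\<And>e e'. (\<alpha> *\<^sub>R mat 1 + H) *v ((\<alpha> *\<^sub>R mat 1 + S) *v e')
        = (\<alpha>\<^sup>2 *\<^sub>R mat 1 + H ** S - ((1 - \<omega>) * \<alpha>) *\<^sub>R (H + S)) *v e
      \<Longrightarrow> norm ((\<alpha> *\<^sub>R mat 1 + S) *v e') \<le> c * norm ((\<alpha> *\<^sub>R mat 1 + S) *v e)"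
proof -
  let ?HP = "\<alpha> *\<^sub>R mat 1 + H" and ?HM = "\<alpha> *\<^sub>R mat 1 - H"
  let ?SP = "\<alpha> *\<^sub>R mat 1 + S" and ?SM = "\<alpha> *\<^sub>R mat 1 - S"
  have inv: "invertible ?HP"
    using \<open>\<alpha> > 0\<close> by (rule invertible_shift_of_accretive) (metis pos inner_zero_left less_eq_real_def)
  obtain q where q: "0 \<le> q" "q < 1"
    "\<And>v. norm (matrix_inv ?HP *v (?HM *v v)) \<le> q * norm v"
    using cayley_transform_contracts[OF \<open>\<alpha> > 0\<close> pos] by blast
  define c where "c = (1 - \<omega> / 2) * q + \<omega> / 2"
  have "norm (?SP *v e') \<le> c * norm (?SP *v e)"
    if eq: "?HP *v (?SP *v e') = (\<alpha>\<^sup>2 *\<^sub>R mat 1 + H ** S - ((1 - \<omega>) * \<alpha>) *\<^sub>R (H + S)) *v e" for e e'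
  proof -
    define u where "u = matrix_inv ?HP *v (?HM *v (?SM *v e))"
    \<comment> \<open>the polynomial identity
      \<open>\<alpha>\<^sup>2 + hs - (1 - \<omega>)\<alpha>(h + s) = (1 - \<omega>/2)(\<alpha> - h)(\<alpha> - s) + (\<omega>/2)(\<alpha> + h)(\<alpha> + s)\<close>;
      it respects the order of \<open>h\<close> and \<open>s\<close>, so it holds for matrices\<close>
    have "?HP *v (?SP *v e') = (1 - \<omega> / 2) *\<^sub>R (?HM *v (?SM *v e)) + (\<omega> / 2) *\<^sub>R (?HP *v (?SP *v e))"
    proof -
      define \<tau> where "\<tau> = \<omega> / 2"
      then have "\<omega> = 2 * \<tau>" by simp
      show ?thesis
        unfolding eq \<open>\<omega> = 2 * \<tau>\<close>
        by (simp add: matrix_expression_mult_vec vec_eq_iff scaleR_conv_of_real[where 'a = complex] algebra_simps power2_eq_square)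
    qed
    then have "matrix_inv ?HP *v (?HP *v (?SP *v e'))
      = (1 - \<omega> / 2) *\<^sub>R u + (\<omega> / 2) *\<^sub>R (matrix_inv ?HP *v (?HP *v (?SP *v e)))"
      by (simp only: u_def matrix_vector_right_distrib matrix_mult_vec_scaleR)
    then have "?SP *v e' = (1 - \<omega> / 2) *\<^sub>R u + (\<omega> / 2) *\<^sub>R (?SP *v e)"
      by (simp only: matrix_inv_cancel[OF inv])
    then have triangle: "norm (?SP *v e') \<le> (1 - \<omega> / 2) * norm u + (\<omega> / 2) * norm (?SP *v e)"
      using norm_triangle_ineq[of "(1 - \<omega> / 2) *\<^sub>R u" "(\<omega> / 2) *\<^sub>R (?SP *v e)"] \<open>0 \<le> \<omega>\<close> \<open>\<omega> < 2\<close> by simp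
    have norm_u: "norm u \<le> q * norm (?SP *v e)"
    proof -
      have "(norm (?SP *v e))\<^sup>2 = (norm (?SM *v e))\<^sup>2"
        using norm_shift_add_minus[of \<alpha> S e] by (simp add: skew)
      then show ?thesis using q(3)[of "?SM *v e"] by (simp add: u_def)
    qed
    note triangle
    also have "(1 - \<omega> / 2) * norm u + (\<omega> / 2) * norm (?SP *v e)
        \<le> (1 - \<omega> / 2) * (q * norm (?SP *v e)) + (\<omega> / 2) * norm (?SP *v e)"
      using \<open>\<omega> < 2\<close> norm_u by (intro add_right_mono mult_left_mono) auto
    also have "\<dots> = c * norm (?SP *v e)"
      by (simp only: c_def distrib_right mult.assoc)
    finally show ?thesis .
  qed
  moreover have "0 \<le> c" using \<open>0 \<le> \<omega>\<close> \<open>\<omega> < 2\<close> q(1) by (simp add: c_def)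
  moreover have "c < 1"
  proof -
    have "(1 - \<omega> / 2) * q < (1 - \<omega> / 2) * 1"
      using \<open>\<omega> < 2\<close> q(2) by (intro mult_strict_left_mono) auto
    then show ?thesis by (simp add: c_def)
  qed
  ultimately show thesis using that by blast
qed

section \<open>Spectra of complex matrices\<close>

lemma poly_det: "poly (det M) z = det (\<chi> i j. poly (M $ i $ j) z)" for M :: "'a::comm_ring_1 poly^'n^'n"
  by (simp add: det_def poly_sum poly_prod)

lemma det_scale: "det (\<chi> i j. c * M $ i $ j) = c ^ CARD('n) * det M" for M :: "'a::comm_ring_1^'n^'n"
  by (simp add: det_def prod.distrib sum_distrib_left mult_ac)

text \<open>
  The determinant is taken over the polynomial ring, so that the spectrum becomes the root set of
  an element of \<open>complex poly\<close>.
\<close>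

definition charpoly :: "complex^'n^'n \<Rightarrow> complex poly" where
  "charpoly M = det (\<chi> i j. (if i = j then [:0, 1:] else 0) - [:M $ i $ j:])"

lemma poly_charpoly: "poly (charpoly M) z = det (\<chi> i j. (if i = j then z else 0) - M $ i $ j)"
  unfolding charpoly_def poly_det by (rule arg_cong[of _ _ det]) (simp add: vec_eq_iff)

lemma matrix_spectrum_eq_roots: "matrix_spectrum M = {z. poly (charpoly M) z = 0}"
  for M :: "complex^'n^'n"
proof -
  have "z \<in> matrix_spectrum M \<longleftrightarrow> poly (charpoly M) z = 0" for z
  proof -
    let ?R = "(\<chi> i j. (if i = j then z else 0) - M $ i $ j) :: complex^'n^'n"
    have R: "?R *v v = z *s v - M *v v" for v
      by (simp add: vec_eq_iff matrix_vector_mult_def left_diff_distrib sum_subtractf if_distrib[of "\<lambda>x. x * _"] cong: if_cong)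
    have "z \<in> matrix_spectrum M \<longleftrightarrow> (\<exists>v. v \<noteq> 0 \<and> ?R *v v = 0)"
      unfolding matrix_spectrum_def by (auto simp: R)
    also have "\<dots> \<longleftrightarrow> \<not> invertible ?R"
      unfolding invertible_left_inverse matrix_left_invertible_ker by blast
    finally show ?thesis by (simp add: poly_charpoly invertible_det_nz)
  qed
  then show ?thesis by blast
qed

text \<open>
  Substituting \<open>z = 1/w\<close> and clearing denominators turns \<open>det (zI - M)\<close> into
  \<open>det (I - wM) = w\<^sup>n det (w\<^sup>-\<^sup>1I - M)\<close>, where \<open>n \<ge> 1\<close> is the size of \<open>M\<close>. If the characteristic
  polynomial were a constant \<open>c\<close>, the polynomial \<open>det (I - wM)\<close> would be \<open>c w\<^sup>n\<close>; yet at
  \<open>w = 0\<close> its value is \<open>1\<close>.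
\<close>

lemma charpoly_nonconstant: "\<not> constant (poly (charpoly M))" for M :: "complex^'n^'n"
proof
  assume "constant (poly (charpoly M))"
  then obtain c where c: "\<And>z. poly (charpoly M) z = c"
    unfolding constant_def by metis
  define r where "r = det ((\<chi> i j. (if i = j then 1 else 0) - [:0, M $ i $ j:]) :: complex poly^'n^'n)"
  have r: "poly r w = det (\<chi> i j. (if i = j then 1 else 0) - w * M $ i $ j)" for w
    unfolding r_def poly_det by (rule arg_cong[of _ _ det]) (simp add: vec_eq_iff)
  have "poly r w = w ^ CARD('n) * c" if "w \<noteq> 0" for w
  proof -
    have "poly r w = det (\<chi> i j. w * (\<chi> i j. (if i = j then 1 / w else 0) - M $ i $ j) $ i $ j)"
      unfolding r using that by (intro arg_cong[of _ _ det]) (simp add: vec_eq_iff right_diff_distrib)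
    also have "\<dots> = w ^ CARD('n) * c"
      unfolding det_scale using c[of "1 / w"] by (simp add: poly_charpoly)
    finally show ?thesis .
  qed
  \<comment> \<open>multiplying by the indeterminate makes the identity hold at \<open>w = 0\<close> as well\<close>
  then have "poly ([:0, 1:] * r) w = poly ([:0, 1:] * monom c CARD('n)) w" for w
    by (cases "w = 0") (simp_all add: poly_monom)
  then have "[:0, 1:] * r = [:0, 1:] * monom c CARD('n)"
    by (simp add: poly_eq_poly_eq_iff[symmetric] fun_eq_iff del: mult_pCons_left)
  then have "r = monom c CARD('n)"
    by (metis mult_left_cancel pCons_eq_0_iff one_neq_zero)
  then have "poly r 0 = 0" by (simp add: poly_monom)
  moreover have "poly r 0 = det (mat 1 :: complex^'n^'n)" by (simp add: r mat_def)
  ultimately show False by simp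
qed

lemma finite_matrix_spectrum: "finite (matrix_spectrum M)"
proof -
  have "charpoly M \<noteq> 0" using charpoly_nonconstant[of M] by (auto simp: constant_def)
  then show ?thesis unfolding matrix_spectrum_eq_roots by (rule poly_roots_finite)
qed

lemma matrix_spectrum_nonempty: "matrix_spectrum M \<noteq> {}"
  using fundamental_theorem_of_algebra[OF charpoly_nonconstant, of M]
  by (auto simp: matrix_spectrum_eq_roots)

text \<open>
  The spectrum is finite and nonempty, so its maximum modulus is attained by an actual eigenvalue.
\<close>

lemma matrix_spectral_radius_less:
  assumes "\<And>z v. v \<noteq> 0 \<Longrightarrow> M *v v = z *s v \<Longrightarrow> norm z < r"
  shows "matrix_spectral_radius M < r"
  using assms finite_matrix_spectrum[of M] matrix_spectrum_nonempty[of M]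
  unfolding matrix_spectral_radius_def by (subst Max_less_iff) (auto simp: matrix_spectrum_def)


section \<open>Convergence of the splitting iteration\<close>

lemma norm_scalar_mult_vec: "norm (z *s w) = norm z * norm w" for w :: "complex^'n"
  by (simp add: norm_vec_def norm_mult L2_set_right_distrib)

text \<open>
  Multiplying the second half-step by \<open>\<alpha>I + H\<close> allows the half-step iterate to be eliminated with
  the first one, since \<open>\<alpha>I + H\<close> commutes with scalars. The data \<open>b = (H + S) xs\<close> then cancel
  because \<open>(\<alpha>I + H)(\<alpha>I + S)\<close> and the matrix on the right differ by \<open>(2 - \<omega>)\<alpha>(H + S)\<close>.
\<close>

lemma splitting_iteration_error:
  fixes A :: "complex^'n^'n"
  assumes iter: "splitting_iteration A b \<alpha> \<omega> x xh" and sol: "A *v xs = b"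
  defines "H \<equiv> hermitian_part A" and "S \<equiv> skew_hermitian_part A"
  shows "(\<alpha> *\<^sub>R mat 1 + H) *v ((\<alpha> *\<^sub>R mat 1 + S) *v (x (Suc k) - xs))
      = (\<alpha>\<^sup>2 *\<^sub>R mat 1 + H ** S - ((1 - \<omega>) * \<alpha>) *\<^sub>R (H + S)) *v (x k - xs)"
proof -
  let ?HP = "\<alpha> *\<^sub>R mat 1 + H" and ?SP = "\<alpha> *\<^sub>R mat 1 + S"
  have half: "?HP *v xh k = (\<alpha> *\<^sub>R mat 1 - S) *v x k + (H + S) *v xs"
    and full: "?SP *v x (Suc k) = (S - ((1 - \<omega>) * \<alpha>) *\<^sub>R mat 1) *v x k + ((2 - \<omega>) * \<alpha>) *\<^sub>R xh k"
    using iter sol by (simp_all add: splitting_iteration_def Let_def H_def S_def hermitian_plus_skew)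
  have "?HP *v (?SP *v x (Suc k)) = ?HP *v ((S - ((1 - \<omega>) * \<alpha>) *\<^sub>R mat 1) *v x k)
      + ((2 - \<omega>) * \<alpha>) *\<^sub>R ((\<alpha> *\<^sub>R mat 1 - S) *v x k + (H + S) *v xs)"
    unfolding full matrix_vector_right_distrib matrix_mult_vec_scaleR half ..
  then have "?HP *v (?SP *v (x (Suc k) - xs)) = ?HP *v ((S - ((1 - \<omega>) * \<alpha>) *\<^sub>R mat 1) *v x k)
      + ((2 - \<omega>) * \<alpha>) *\<^sub>R ((\<alpha> *\<^sub>R mat 1 - S) *v x k + (H + S) *v xs) - ?HP *v (?SP *v xs)"
    by (simp only: matrix_vector_mult_diff_distrib)
  also have "\<dots> = (\<alpha>\<^sup>2 *\<^sub>R mat 1 + H ** S - ((1 - \<omega>) * \<alpha>) *\<^sub>R (H + S)) *v (x k - xs)"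
    by (simp add: matrix_expression_mult_vec vec_eq_iff scaleR_conv_of_real[where 'a = complex] algebra_simps power2_eq_square)
  finally show ?thesis .
qed

lemma splitting_iteration_exists:
  assumes "invertible (\<alpha> *\<^sub>R mat 1 + hermitian_part A)"
    and "invertible (\<alpha> *\<^sub>R mat 1 + skew_hermitian_part A)"
  shows "\<exists>x xh. x 0 = x0 \<and> splitting_iteration A b \<alpha> \<omega> x xh"
proof -
  let ?H = "hermitian_part A" and ?S = "skew_hermitian_part A"
  define half where "half y = matrix_inv (\<alpha> *\<^sub>R mat 1 + ?H) *v ((\<alpha> *\<^sub>R mat 1 - ?S) *v y + b)" for y
  define full where "full y = matrix_inv (\<alpha> *\<^sub>R mat 1 + ?S) *v
      ((?S - ((1 - \<omega>) * \<alpha>) *\<^sub>R mat 1) *v y + ((2 - \<omega>) * \<alpha>) *\<^sub>R half y)" for y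
  define x where "x = rec_nat x0 (\<lambda>_. full)"
  have "x 0 = x0" "\<And>k. x (Suc k) = full (x k)" by (simp_all add: x_def)
  then have "x 0 = x0 \<and> splitting_iteration A b \<alpha> \<omega> x (half \<circ> x)"
    using assms by (simp add: splitting_iteration_def Let_def full_def half_def matrix_inv_cancel)
  then show ?thesis by blast
qed

theorem theorem2p4:
  fixes A :: "complex^'n^'n" and b :: "complex^'n" and \<alpha> \<omega> :: real
  assumes "\<not> hermitian_matrix A"
    and "posdef_matrix A"
    and "\<alpha> > 0"
    and "0 \<le> \<omega>" and "\<omega> < 2"
  shows "invertible (\<alpha> *\<^sub>R mat 1 + hermitian_part A)
       \<and> invertible (\<alpha> *\<^sub>R mat 1 + skew_hermitian_part A)
       \<and> (\<exists>xs. (\<forall>z. A *v z = b \<longleftrightarrow> z = xs) \<and>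
            (\<forall>x0. (\<exists>x xh. x 0 = x0 \<and> splitting_iteration A b \<alpha> \<omega> x xh) \<and>
                  (\<forall>x xh. x 0 = x0 \<and> splitting_iteration A b \<alpha> \<omega> x xh \<longrightarrow> x \<longlonglongrightarrow> xs)))
       \<and> matrix_spectral_radius (iteration_matrix A \<alpha> \<omega>) < 1"
proof -
  define H where "H = hermitian_part A"
  define S where "S = skew_hermitian_part A"
  let ?HP = "\<alpha> *\<^sub>R mat 1 + H" and ?SP = "\<alpha> *\<^sub>R mat 1 + S"
  let ?N = "\<alpha>\<^sup>2 *\<^sub>R mat 1 + H ** S - ((1 - \<omega>) * \<alpha>) *\<^sub>R (H + S)"
  have pos: "v \<bullet> (H *v v) > 0" if "v \<noteq> 0" for v
    unfolding H_def using assms(2) that by (rule posdef_matrix_inner_pos)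
  have skew: "v \<bullet> (S *v v) = 0" for v
    unfolding S_def by (rule inner_skew_hermitian_part)
  have invH: "invertible ?HP"
    using assms(3) by (rule invertible_shift_of_accretive) (metis pos inner_zero_left less_eq_real_def)
  have invS: "invertible ?SP"
    using assms(3) by (rule invertible_shift_of_accretive) (simp add: skew)
  have invA: "invertible A"
  proof (rule invertible_if_ker_trivial)
    fix v assume "A *v v = 0"
    then have "v \<bullet> (H *v v) = 0" by (simp add: H_def inner_hermitian_part)
    then show "v = 0" using pos[of v] by auto
  qed
  define xs where "xs = matrix_inv A *v b"
  have sol: "A *v z = b \<longleftrightarrow> z = xs" for z
    unfolding xs_def using matrix_inv_cancel[OF invA] by metis
  obtain c where c: "0 \<le> c" "c < 1"
    and step: "\<And>e e'. ?HP *v (?SP *v e') = ?N *v e \<Longrightarrow> norm (?SP *v e') \<le> c * norm (?SP *v e)"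
    using splitting_step_contracts[OF assms(3-5) pos skew] by blast

  have conv: "x \<longlonglongrightarrow> xs" if iter: "splitting_iteration A b \<alpha> \<omega> x xh" for x xh
  proof -
    define w where "w k = ?SP *v (x k - xs)" for k
    have "norm (w (Suc k)) \<le> c * norm (w k)" for k
      unfolding w_def
      by (rule step) (use splitting_iteration_error[OF iter, of xs] sol in \<open>simp add: H_def S_def\<close>)
    then have bound: "norm (w k) \<le> c ^ k * norm (w 0)" for k
    proof (induction k)
      case (Suc k)
      have "norm (w (Suc k)) \<le> c * norm (w k)" by (rule Suc.prems)
      also have "\<dots> \<le> c * (c ^ k * norm (w 0))"
        using Suc c(1) by (intro mult_left_mono) auto
      finally show ?case by simp
    qed simp
    have "(\<lambda>k. c ^ k * norm (w 0)) \<longlonglongrightarrow> 0"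
      using c by (intro tendsto_mult_left_zero LIMSEQ_power_zero) auto
    then have "w \<longlonglongrightarrow> 0"
      by (rule Lim_null_comparison[rotated]) (simp add: bound)
    then have "(\<lambda>k. matrix_inv ?SP *v w k) \<longlonglongrightarrow> matrix_inv ?SP *v 0"
      by (rule bounded_linear.tendsto[rotated])
        (use linear_complex_matrix_vector_mult linear_conv_bounded_linear in blast)
    then have "(\<lambda>k. x k - xs) \<longlonglongrightarrow> 0"
      by (simp add: w_def matrix_inv_cancel[OF invS])
    then show ?thesis by (rule LIM_zero_cancel)
  qed

  have "matrix_spectral_radius (iteration_matrix A \<alpha> \<omega>) < 1"
  proof (rule matrix_spectral_radius_less)
    fix z v assume "v \<noteq> 0" and eig: "iteration_matrix A \<alpha> \<omega> *v v = z *s v"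
    have "iteration_matrix A \<alpha> \<omega> *v v = matrix_inv ?SP *v (matrix_inv ?HP *v (?N *v v))"
      by (simp add: iteration_matrix_def H_def S_def hermitian_plus_skew matrix_vector_mul_assoc Let_def matrix_mul_assoc)
    then have "?HP *v (?SP *v (z *s v)) = ?N *v v"
      by (simp add: matrix_inv_cancel[OF invS] matrix_inv_cancel[OF invH] flip: eig)
    then have "norm (?SP *v (z *s v)) \<le> c * norm (?SP *v v)" by (rule step)
    then have "norm z * norm (?SP *v v) \<le> c * norm (?SP *v v)"
      by (simp only: vector_scalar_commute norm_scalar_mult_vec)
    moreover have "?SP *v v \<noteq> 0"
      using \<open>v \<noteq> 0\<close> matrix_inv_cancel(2)[OF invS, of v] by auto
    ultimately have "norm z \<le> c" by simp
    then show "norm z < 1" using c(2) by simp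
  qed
  then show ?thesis
    using invH invS sol conv splitting_iteration_exists[of \<alpha> A] unfolding H_def S_def by blast
qed

end
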